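(* Let $\boldsymbol{\gamma}=(\gamma_{ij})_{i,j=1,\dots,m}:\mathbb{R}^l\to\mathbb{R}^{m\times m}$ be a pseudo-variogram. Then the function $\boldsymbol{G}:\mathbb{R}^d\times\mathbb{R}^l\to\mathbb{R}^{m\times m}$ with $$G_{ij}(\boldsymbol{h},\boldsymbol{u})=\frac{1}{(1+\gamma_{ij}(\boldsymbol{u}))^{r}}\,\varphi\left(\frac{\lVert\boldsymbol{h}\rVert^2}{1+\gamma_{ij}(\boldsymbol{u})}\right),\quad(\boldsymbol{h},\boldsymbol{u})\in\mathbb{R}^d\times\mathbb{R}^l,\ i,j=1,\dots,m,$$ is a matrix-valued correlation function for $r\ge\frac d2$ and a bounded completely monotone function $\varphi$.
   Context: Here $d,l,m\in\mathbb{N}$. Random fields are real-vector-valued; $\lVert\cdot\rVert$ is the Euclidean norm. An $m$-variate random field $\boldsymbol{Z}$ on $\mathbb{R}^p$ is second-order stationary if it has constant mean and $\mathrm{Cov}(Z_i(\boldsymbol{x}+\boldsymbol{k}),Z_j(\boldsymbol{x}))$ exists and depends only on $\boldsymbol{k}$ for all $i,j$; it is intrinsically stationary if $\{\boldsymbol{Z}(\boldsymbol{x}+\boldsymbol{k})-\boldsymbol{Z}(\boldsymbol{x}),\ \boldsymbol{x}\in\mathbb{R}^p\}$ is second-order stationary for every $\boldsymbol{k}\in\mathbb{R}^p$. Pseudo-variogram: if $\boldsymbol{Z}$ is an intrinsically stationary $m$-variate random field on $\mathbb{R}^l$ and, additionally, $Z_i(\boldsymbol{t}+\boldsymbol{u})-Z_j(\boldsymbol{t})$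 is square integrable with variance not depending on $\boldsymbol{t}$, for all $\boldsymbol{t},\boldsymbol{u}\in\mathbb{R}^l$, $i,j=1,\dots,m$, then the pseudo-variogram of $\boldsymbol{Z}$ is $\gamma_{ij}(\boldsymbol{u})=\frac12\mathrm{Var}(Z_i(\boldsymbol{t}+\boldsymbol{u})-Z_j(\boldsymbol{t}))$. A function is called a pseudo-variogram if it is the pseudo-variogram of some such random field. "Bounded completely monotone function" means the continuous extension $\varphi:[0,\infty)\to[0,\infty)$ of a bounded completely monotone function on $(0,\infty)$ (a $C^\infty$ function $\varphi$ with $(-1)^n\varphi^{(n)}\ge0$ for all $n\ge0$). Matrix-valued correlation function on $\mathbb{R}^p$ (here $p=d+l$, $\mathbb{R}^d\times\mathbb{R}^l\cong\mathbb{R}^{d+l}$): a function $\boldsymbol{C}:\mathbb{R}^p\to\mathbb{R}^{m\times m}$ that is the covariance function $C_{ij}(\boldsymbol{k})=\mathrm{Cov}(Z_i(\boldsymbol{x}+\boldsymbol{k}),Z_j(\boldsymbol{x}))$ of a second-order stationary $m$-variate random field and satisfies $C_{ii}(\boldsymbol{0})=1$ for all $i$.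
   Formalization: Since G_ii(0,0) = φ(0), the claim fails unless φ(0) = 1 (e.g. φ ≡ 2); G is shown to be a matrix-valued correlation function when φ(0) = 1, and a matrix-valued covariance function of a second-order stationary field for every bounded completely monotone φ. *)

theory Defs
  imports "HOL-Probability.Probability"
begin

definition covariance :: "'w measure \<Rightarrow> ('w \<Rightarrow> real) \<Rightarrow> ('w \<Rightarrow> real) \<Rightarrow> real" where
  "covariance M X Y =
     (\<integral>\<omega>. (X \<omega> - (\<integral>\<omega>'. X \<omega>' \<partial>M)) * (Y \<omega> - (\<integral>\<omega>'. Y \<omega>' \<partial>M)) \<partial>M)"

text \<open>
  The Bochner integral of a non-integrable function is 0, so existence of moments has to be
  demanded explicitly wherever the mathematics speaks of a covariance or a mean.
\<close>

definition covariance_exists :: "'w measure \<Rightarrow> ('w \<Rightarrow> real) \<Rightarrow> ('w \<Rightarrow> real) \<Rightarrow> bool" where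
  "covariance_exists M X Y \<longleftrightarrow> integrable M X \<and> integrable M Y \<and>
     integrable M (\<lambda>\<omega>. (X \<omega> - (\<integral>\<omega>'. X \<omega>' \<partial>M)) * (Y \<omega> - (\<integral>\<omega>'. Y \<omega>' \<partial>M)))"

definition random_field :: "'w measure \<Rightarrow> ('p::euclidean_space \<Rightarrow> 'w \<Rightarrow> real ^ 'm) \<Rightarrow> bool" where
  "random_field M Z \<longleftrightarrow> prob_space M \<and> (\<forall>x. Z x \<in> borel_measurable M)"

definition second_order_stationary ::
    "'w measure \<Rightarrow> ('p::euclidean_space \<Rightarrow> 'w \<Rightarrow> real ^ 'm) \<Rightarrow> bool" where
  "second_order_stationary M Z \<longleftrightarrow>
     random_field M Z \<and>
     (\<forall>x. integrable M (Z x)) \<and>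
     (\<exists>\<mu>. \<forall>x. (\<integral>\<omega>. Z x \<omega> \<partial>M) = \<mu>) \<and>
     (\<forall>i j x k. covariance_exists M (\<lambda>\<omega>. Z (x + k) \<omega> $ i) (\<lambda>\<omega>. Z x \<omega> $ j)) \<and>
     (\<forall>i j k. \<exists>c. \<forall>x. covariance M (\<lambda>\<omega>. Z (x + k) \<omega> $ i) (\<lambda>\<omega>. Z x \<omega> $ j) = c)"

definition intrinsically_stationary ::
    "'w measure \<Rightarrow> ('p::euclidean_space \<Rightarrow> 'w \<Rightarrow> real ^ 'm) \<Rightarrow> bool" where
  "intrinsically_stationary M Z \<longleftrightarrow>
     random_field M Z \<and> (\<forall>k. second_order_stationary M (\<lambda>x \<omega>. Z (x + k) \<omega> - Z x \<omega>))"

text \<open>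
  \<open>\<gamma>\<close> is the pseudo-variogram of \<open>Z\<close>; that the variance does not depend on \<open>t\<close> is expressed by
  requiring the last equation for all \<open>t\<close>.
\<close>

definition pseudo_variogram_of ::
    "'w measure \<Rightarrow> ('p::euclidean_space \<Rightarrow> 'w \<Rightarrow> real ^ 'm) \<Rightarrow> ('p \<Rightarrow> real ^ 'm ^ 'm) \<Rightarrow> bool" where
  "pseudo_variogram_of M Z \<gamma> \<longleftrightarrow>
     intrinsically_stationary M Z \<and>
     (\<forall>t u i j. integrable M (\<lambda>\<omega>. (Z (t + u) \<omega> $ i - Z t \<omega> $ j)\<^sup>2)) \<and>
     (\<forall>t u i j. \<gamma> u $ i $ j = 1 / 2 * prob_space.variance M (\<lambda>\<omega>. Z (t + u) \<omega> $ i - Z t \<omega> $ j))"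

definition covariance_function_of ::
    "'w measure \<Rightarrow> ('p::euclidean_space \<Rightarrow> 'w \<Rightarrow> real ^ 'm) \<Rightarrow> ('p \<Rightarrow> real ^ 'm ^ 'm) \<Rightarrow> bool" where
  "covariance_function_of M Z C \<longleftrightarrow>
     second_order_stationary M Z \<and>
     (\<forall>x k i j. C k $ i $ j = covariance M (\<lambda>\<omega>. Z (x + k) \<omega> $ i) (\<lambda>\<omega>. Z x \<omega> $ j))"

text \<open>
  One cannot quantify over types, so the sample space is taken to be the space of all functions
  from \<open>'p\<close> to \<open>real ^ 'm\<close>. By lemma \<open>matrix_covariance_functionI\<close> below this is no restriction:
  every random field, on any sample space, has the same covariances as its law on path space.
\<close>

definition matrix_covariance_function :: "('p::euclidean_space \<Rightarrow> real ^ 'm ^ 'm) \<Rightarrow> bool" where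
  "matrix_covariance_function C \<longleftrightarrow>
     (\<exists>(M :: ('p \<Rightarrow> real ^ 'm) measure) Z. covariance_function_of M Z C)"

definition matrix_correlation_function :: "('p::euclidean_space \<Rightarrow> real ^ 'm ^ 'm) \<Rightarrow> bool" where
  "matrix_correlation_function C \<longleftrightarrow>
     matrix_covariance_function C \<and> (\<forall>i. C 0 $ i $ i = 1)"

lemma matrix_covariance_functionI:
  fixes M :: "'w measure" and Z :: "'p::euclidean_space \<Rightarrow> 'w \<Rightarrow> real ^ 'm"
  assumes "covariance_function_of M Z C"
  shows "matrix_covariance_function C"
proof -
  define P :: "('p \<Rightarrow> real ^ 'm) measure" where "P = PiM UNIV (\<lambda>_. borel)"
  define T where "T = (\<lambda>\<omega> x. Z x \<omega>)"
  define N where "N = distr M P T"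
  define Y :: "'p \<Rightarrow> ('p \<Rightarrow> real ^ 'm) \<Rightarrow> real ^ 'm" where "Y = (\<lambda>x f. f x)"
  have sos: "second_order_stationary M Z"
    using assms by (simp add: covariance_function_of_def)
  then have ps: "prob_space M" and Z: "\<And>x. Z x \<in> borel_measurable M"
    by (auto simp: second_order_stationary_def random_field_def)
  have T: "T \<in> measurable M P"
    unfolding T_def P_def by (rule measurable_PiM_single') (use Z in \<open>auto simp: space_PiM\<close>)
  have Y: "Y x \<in> borel_measurable P" for x
    unfolding Y_def P_def by (rule measurable_component_singleton) simp
  have YT: "Y x (T \<omega>) = Z x \<omega>" for x \<omega>
    by (simp add: Y_def T_def)
  have nth: "(\<lambda>f. Y x f $ i) \<in> borel_measurable P" for x i
    by (rule measurable_compose[OF Y borel_measurable_continuous_onI]) (intro continuous_intros)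
  have int1: "(\<integral>f. Y x f $ i \<partial>N) = (\<integral>\<omega>. Z x \<omega> $ i \<partial>M)" for x i
    unfolding N_def by (subst integral_distr[OF T nth]) (simp add: YT)
  have cov: "covariance N (\<lambda>f. Y x f $ i) (\<lambda>f. Y y f $ j)
      = covariance M (\<lambda>\<omega>. Z x \<omega> $ i) (\<lambda>\<omega>. Z y \<omega> $ j)" for x y i j
    unfolding covariance_def int1 unfolding N_def
    by (subst integral_distr[OF T]) (use nth in \<open>auto simp: YT\<close>)
  have covex: "covariance_exists N (\<lambda>f. Y x f $ i) (\<lambda>f. Y y f $ j)
      = covariance_exists M (\<lambda>\<omega>. Z x \<omega> $ i) (\<lambda>\<omega>. Z y \<omega> $ j)" for x y i j
    unfolding covariance_exists_def int1 unfolding N_def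
    by (subst (1 2 3) integrable_distr_eq[OF T]) (use nth in \<open>auto simp: YT\<close>)
  have mean: "(\<integral>f. Y x f \<partial>N) = (\<integral>\<omega>. Z x \<omega> \<partial>M)" for x
    unfolding N_def by (subst integral_distr[OF T Y]) (simp add: YT)
  have intg: "integrable N (Y x) = integrable M (Z x)" for x
    unfolding N_def by (subst integrable_distr_eq[OF T Y]) (simp add: YT)
  have "random_field N Y"
    unfolding random_field_def N_def
    using prob_space.prob_space_distr[OF ps T] Y by simp
  then have "covariance_function_of N Y C"
    using assms
    unfolding covariance_function_of_def second_order_stationary_def cov covex mean intg by blast
  then show ?thesis
    unfolding matrix_covariance_function_def by blast
qed

definition completely_monotone :: "(real \<Rightarrow> real) \<Rightarrow> bool" where
  "completely_monotone \<phi> \<longleftrightarrow>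
     (\<forall>n. \<forall>t>0. (deriv ^^ n) \<phi> field_differentiable (at t) \<and> (-1) ^ n * (deriv ^^ n) \<phi> t \<ge> 0)"

text \<open>
  The continuous extension to \<open>[0, \<infinity>)\<close> of a bounded completely monotone function on \<open>(0, \<infinity>)\<close>;
  values at negative arguments are irrelevant.
\<close>

definition bounded_completely_monotone :: "(real \<Rightarrow> real) \<Rightarrow> bool" where
  "bounded_completely_monotone \<phi> \<longleftrightarrow>
     completely_monotone \<phi> \<and> bounded (\<phi> ` {0<..}) \<and>
     continuous_on {0..} \<phi> \<and> (\<forall>t\<ge>0. \<phi> t \<ge> 0)"

end

theory Submission
  imports Defs "HOL-Real_Asymp.Real_Asymp"
begin

text \<open>
  The proof writes down an explicit random field with covariance \<open>G\<close>. Write \<open>a = (u, i)\<close>,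
  \<open>b = (u', j)\<close>, and let \<open>Y\<^sub>a\<close> be the centred increment of \<open>Z\<^sub>i(u)\<close> against one fixed reference
  variable. These variables are square integrable, and
  \<open>\<gamma>\<^sub>i\<^sub>j(u - u') = E (Y\<^sub>a - Y\<^sub>b)\<^sup>2 / 2\<close>: the pseudo-variogram is half a squared distance in
  \<open>L\<^sup>2\<close> (lemma \<open>pseudo_variogram_feature_map\<close>).

  Put \<open>g = \<gamma>\<^sub>i\<^sub>j(u - u')\<close> and \<open>q = r - d/2 \<ge> 0\<close>. Bernstein's theorem represents \<open>\<phi>\<close>, and also
  \<open>y \<mapsto> (1 + y) powr - q\<close>, as Laplace transforms of measures \<open>\<phi>(0) \<mu>\<close> and \<open>\<nu>\<close> on the half-line.
  For a standard normal vector \<open>x\<close> in dimension \<open>d\<close>, completing the square gives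
  \<open>E exp(- g |x|\<^sup>2 / 2) cos(\<surd>(2 s) x \<bullet> k) = (1 + g) powr (- d/2) * exp(- s |k|\<^sup>2 / (1 + g))\<close>.
  The condition \<open>r \<ge> d/2\<close> enters because this Gaussian integral already uses up the power
  \<open>d/2\<close> of \<open>1 + g\<close>. Multiplying and integrating over \<open>s\<close> and \<open>t\<close>,
  \<open>G\<^sub>i\<^sub>j(h - h', u - u') = \<phi>(0) E [cos(\<surd>(2 s) x \<bullet> (h - h')) exp(- (t + |x|\<^sup>2 / 2) g)]\<close>
  where \<open>s\<close>, \<open>t\<close> and \<open>x\<close> are independent with laws \<open>\<mu>\<close>, \<open>\<nu>\<close> and standard normal
  (lemma \<open>mixing_integral\<close>).

  For fixed \<open>(s, t, x)\<close> both factors are second-moment kernels of explicit random functions. A cosine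
  of a difference arises from a random choice between cosine and sine. The factor
  \<open>exp(- V |Y\<^sub>a - Y\<^sub>b|\<^sup>2 / 2)\<close> is, up to a rescaling of the random functions, the exponential of
  the Gram kernel \<open>V E Y\<^sub>a Y\<^sub>b\<close>; its power series is realised by a product of a Poisson number of
  independent copies of \<open>Y\<^sub>a\<close> (lemma \<open>feature_map_exp\<close>). Products of kernels come from
  independent random functions, mixtures from drawing the parameter at random, and an independent random
  sign centres the resulting field.
\<close>

section \<open>Bernstein representation of completely monotone functions\<close>

lemma completely_monotone_has_derivative:
  assumes "completely_monotone \<phi>" "t > 0"
  shows "((deriv ^^ n) \<phi> has_field_derivative (deriv ^^ Suc n) \<phi> t) (at t)"
  using assms by (auto simp: completely_monotone_def DERIV_deriv_iff_field_differentiable)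

lemma completely_monotone_sign:
  assumes "completely_monotone \<phi>" "t > 0"
  shows "0 \<le> (-1) ^ n * (deriv ^^ n) \<phi> t"
  using assms by (auto simp: completely_monotone_def)

text \<open>
  In the variable \<open>c - t\<close> all Taylor coefficients at \<open>c\<close> are nonnegative, and this alone
  forces convergence to \<open>\<phi>\<close> on the whole of \<open>(0, c]\<close>, not just near \<open>c\<close>: the integral remainder at a
  point is dominated by a geometrically decaying multiple of the remainder at a point further out.
\<close>

lemma completely_monotone_Taylor_sums:
  assumes cm: "completely_monotone \<phi>" and t: "0 < t" "t \<le> c"
  shows "(\<lambda>k. (-1) ^ k * (deriv ^^ k) \<phi> c * (c - t) ^ k / fact k) sums \<phi> t"
proof -
  define D where "D = (\<lambda>k s. (-1) ^ k * (deriv ^^ k) \<phi> (c - s))"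
  define x where "x = c - t"
  define b where "b = c - t / 2"
  have xb: "0 \<le> x" "x < b" "b < c" "0 < b" using t by (auto simp: x_def b_def)
  have der: "(D k has_vector_derivative D (Suc k) s) (at s within S)" if "s < c" for k s S
  proof -
    have "((\<lambda>s. (-1) ^ k * (deriv ^^ k) \<phi> (c - s)) has_field_derivative
          (-1) ^ k * ((deriv ^^ Suc k) \<phi> (c - s) * (-1))) (at s)"
      by (rule DERIV_cmult, rule DERIV_chain2[OF completely_monotone_has_derivative[OF cm]])
         (use that in \<open>auto intro!: derivative_eq_intros\<close>)
    then show ?thesis
      by (auto simp: D_def has_real_derivative_iff_has_vector_derivative
               intro: has_vector_derivative_at_within)
  qed
  have D_nonneg: "0 \<le> D k s" if "s < c" for k s
    using completely_monotone_sign[OF cm, of "c - s" k] that by (simp add: D_def)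
  define R where "R = (\<lambda>n y. integral {0..y} (\<lambda>s. ((y - s) ^ n / fact n) *\<^sub>R D (Suc n) s))"
  have Taylor: "\<phi> (c - y) = (\<Sum>k<Suc n. (y ^ k / fact k) *\<^sub>R D k 0) + R n y"
    and int: "(\<lambda>s. ((y - s) ^ n / fact n) *\<^sub>R D (Suc n) s) integrable_on {0..y}"
    if "0 \<le> y" "y < c" for y n
    using Taylor_integral[of "Suc n" D "\<lambda>s. \<phi> (c - s)" 0 y]
      Taylor_integrable[of "Suc n" D "\<lambda>s. \<phi> (c - s)" 0 y] der that
    by (auto simp: D_def R_def)
  have R_nonneg: "0 \<le> R n y" if "0 \<le> y" "y < c" for n y
    unfolding R_def using that D_nonneg by (intro integral_nonneg int) auto
  have R_b: "R n b \<le> \<phi> (t / 2)" for n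
  proof -
    have "0 \<le> (\<Sum>k<Suc n. (b ^ k / fact k) *\<^sub>R D k 0)"
      using xb D_nonneg by (intro sum_nonneg) auto
    with Taylor[of b n] xb show ?thesis by (simp add: b_def)
  qed
  \<comment> \<open>Since \<open>x - s \<le> (x / b) (b - s)\<close>, the remainder at \<open>x\<close> is geometrically smaller than
      the one at \<open>b\<close>, which stays bounded because all Taylor coefficients are nonnegative.\<close>
  have R_x: "R n x \<le> (x / b) ^ n * R n b" for n
  proof -
    have int_b: "(\<lambda>s. ((b - s) ^ n / fact n) *\<^sub>R D (Suc n) s) integrable_on {0..b}"
      using xb by (intro int) auto
    have int_bx: "(\<lambda>s. ((b - s) ^ n / fact n) *\<^sub>R D (Suc n) s) integrable_on {0..x}"
      by (rule integrable_subinterval_real[OF int_b]) (use xb in auto)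
    have "R n x \<le> integral {0..x} (\<lambda>s. (x / b) ^ n * (((b - s) ^ n / fact n) *\<^sub>R D (Suc n) s))"
      unfolding R_def
    proof (rule integral_le)
      show "(\<lambda>s. ((x - s) ^ n / fact n) *\<^sub>R D (Suc n) s) integrable_on {0..x}"
        using xb by (intro int) auto
      show "(\<lambda>s. (x / b) ^ n * (((b - s) ^ n / fact n) *\<^sub>R D (Suc n) s)) integrable_on {0..x}"
        using integrable_on_cmult_left[OF int_bx, of "(x / b) ^ n"] by simp
    next
      fix s assume s: "s \<in> {0..x}"
      have "x - s \<le> x / b * (b - s)"
      proof -
        have "x * s \<le> b * s" using s xb by (intro mult_right_mono) auto
        then show ?thesis using xb by (simp add: field_simps)
      qed
      then have "(x - s) ^ n \<le> (x / b * (b - s)) ^ n"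
        using s by (intro power_mono) auto
      then have "(x - s) ^ n / fact n * D (Suc n) s
          \<le> (x / b * (b - s)) ^ n / fact n * D (Suc n) s"
        using s xb by (intro mult_right_mono divide_right_mono D_nonneg) auto
      then show "((x - s) ^ n / fact n) *\<^sub>R D (Suc n) s
          \<le> (x / b) ^ n * (((b - s) ^ n / fact n) *\<^sub>R D (Suc n) s)"
        by (simp add: power_mult_distrib mult_ac power_divide)
    qed
    also have "\<dots> = (x / b) ^ n * integral {0..x} (\<lambda>s. ((b - s) ^ n / fact n) *\<^sub>R D (Suc n) s)"
      by (rule integral_mult_right)
    also have "\<dots> \<le> (x / b) ^ n * R n b"
      unfolding R_def using xb D_nonneg
      by (intro mult_left_mono integral_subset_le int_b int_bx) auto
    finally show ?thesis .
  qed
  have "(\<lambda>n. R n x) \<longlonglongrightarrow> 0"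
  proof (rule tendsto_sandwich)
    show "\<forall>\<^sub>F n in sequentially. 0 \<le> R n x"
      using R_nonneg xb by auto
    have "R n x \<le> (x / b) ^ n * \<phi> (t / 2)" for n
      using R_x[of n] R_b[of n] xb
      by (meson divide_nonneg_pos mult_left_mono order_trans zero_le_power)
    then show "\<forall>\<^sub>F n in sequentially. R n x \<le> (x / b) ^ n * \<phi> (t / 2)"
      by simp
    show "(\<lambda>n. (x / b) ^ n * \<phi> (t / 2)) \<longlonglongrightarrow> 0"
      using xb by (intro tendsto_mult_left_zero LIMSEQ_power_zero) simp
  qed simp
  then have "(\<lambda>n. \<phi> t - R n x) \<longlonglongrightarrow> \<phi> t"
    by (auto intro: tendsto_eq_intros)
  moreover have "\<phi> t - R n x = (\<Sum>k<Suc n. (-1) ^ k * (deriv ^^ k) \<phi> c * (c - t) ^ k / fact k)" for n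
    using Taylor[of x n] xb t by (simp add: x_def D_def mult_ac)
  ultimately show ?thesis
    unfolding sums_def by (subst filterlim_sequentially_Suc[symmetric]) simp
qed

lemma bounded_completely_monotone_antimono:
  assumes "bounded_completely_monotone \<phi>" "0 \<le> s" "s \<le> t"
  shows "\<phi> t \<le> \<phi> s"
proof -
  have cm: "completely_monotone \<phi>" and cont: "continuous_on {0..} \<phi>"
    using assms by (auto simp: bounded_completely_monotone_def)
  show ?thesis
  proof (rule DERIV_nonpos_imp_decreasing_open[of s t \<phi>])
    show "s \<le> t" using assms by simp
    show "continuous_on {s..t} \<phi>"
      using cont by (rule continuous_on_subset) (use assms in auto)
    show "\<exists>y. (\<phi> has_real_derivative y) (at x) \<and> y \<le> 0" if "s < x" "x < t" for x
      using completely_monotone_has_derivative[OF cm, of x 0]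
        completely_monotone_sign[OF cm, of x 1] that assms by auto
  qed
qed

lemma integral_measure_pmf_nat_sums:
  fixes f :: "nat \<Rightarrow> real"
  assumes "summable (\<lambda>k. pmf p k * \<bar>f k\<bar>)"
  shows "integrable (measure_pmf p) f"
    and "(\<lambda>k. pmf p k * f k) sums (\<integral>k. f k \<partial>measure_pmf p)"
proof -
  have int: "integrable (count_space UNIV) (\<lambda>k. pmf p k * f k)"
    using assms by (simp add: integrable_count_space_nat_iff abs_mult)
  show "integrable (measure_pmf p) f"
    using int by (simp add: measure_pmf_eq_density integrable_density)
  show "(\<lambda>k. pmf p k * f k) sums (\<integral>k. f k \<partial>measure_pmf p)"
    using sums_integral_count_space_nat[OF int] by (simp add: measure_pmf_eq_density integral_density)
qed

text \<open>
  The Taylor coefficients at \<open>c\<close>, taken in the variable \<open>z = 1 - t/c\<close> and divided by \<open>\<phi>(0)\<close>,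
  form a probability distribution on the natural numbers: they are nonnegative, and they sum to the limit
  of \<open>\<phi>(c - c z) / \<phi>(0)\<close> at \<open>z = 1\<close>, which is 1 because \<open>\<phi>\<close> is continuous at 0. So \<open>\<phi>\<close> is its
  probability generating function.
\<close>

lemma bounded_completely_monotone_Taylor_pmf:
  assumes bcm: "bounded_completely_monotone \<phi>" and pos: "0 < \<phi> 0" and c: "0 < c"
  obtains p :: "nat pmf"
  where "\<And>z. 0 \<le> z \<Longrightarrow> z < 1 \<Longrightarrow> \<phi> (c - c * z) = \<phi> 0 * (\<integral>k. z ^ k \<partial>measure_pmf p)"
proof -
  have cm: "completely_monotone \<phi>" and cont: "continuous_on {0..} \<phi>"
    using bcm by (auto simp: bounded_completely_monotone_def)
  define a where "a k = (-1) ^ k * (deriv ^^ k) \<phi> c * c ^ k / fact k" for k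
  have a_nonneg: "0 \<le> a k" for k
    using completely_monotone_sign[OF cm c, of k] c by (simp add: a_def)
  have a_sums: "(\<lambda>k. a k * z ^ k) sums \<phi> (c - c * z)" if "0 \<le> z" "z < 1" for z
    using completely_monotone_Taylor_sums[OF cm, of "c - c * z" c] that c
    by (simp add: a_def power_mult_distrib mult_ac)
  have lim: "((\<lambda>z. \<phi> (c - c * z)) \<longlongrightarrow> \<phi> 0) (at_left 1)"
  proof -
    have "continuous_on {0..1} (\<lambda>z. \<phi> (c - c * z))"
      by (rule continuous_on_compose2[OF cont]) (use c in \<open>auto intro!: continuous_intros\<close>)
    then have "((\<lambda>z. \<phi> (c - c * z)) \<longlongrightarrow> \<phi> (c - c * 1)) (at 1 within {0..1})"
      unfolding continuous_on by (rule bspec) simp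
    then show ?thesis by (simp add: at_within_Icc_at_left)
  qed
  have near1: "\<forall>\<^sub>F z in at_left (1::real). 0 \<le> z \<and> z < 1"
    using eventually_at_left_real[of 0 "1::real"] by (rule eventually_mono) auto
  have partial_le: "(\<Sum>k<n. a k) \<le> \<phi> 0" for n
  proof -
    have "((\<lambda>z. \<Sum>k<n. a k * z ^ k) \<longlongrightarrow> (\<Sum>k<n. a k * 1 ^ k)) (at_left 1)"
      by (intro tendsto_intros)
    moreover have "\<forall>\<^sub>F z in at_left 1. (\<Sum>k<n. a k * z ^ k) \<le> \<phi> (c - c * z)"
      using near1
    proof (rule eventually_mono)
      fix z :: real assume z: "0 \<le> z \<and> z < 1"
      then show "(\<Sum>k<n. a k * z ^ k) \<le> \<phi> (c - c * z)"
        using a_sums[of z] a_nonneg sum_le_suminf[of "\<lambda>k. a k * z ^ k" "{..<n}"]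
        by (auto simp: sums_iff)
    qed
    ultimately show ?thesis
      using tendsto_le[OF _ lim] by auto
  qed
  have summable_a: "summable a"
    by (rule summableI_nonneg_bounded[OF a_nonneg partial_le])
  have "suminf a = \<phi> 0"
  proof (rule antisym)
    show "suminf a \<le> \<phi> 0" using summable_a partial_le by (rule suminf_le_const)
    have "\<forall>\<^sub>F z in at_left 1. \<phi> (c - c * z) \<le> suminf a"
      using near1
    proof (rule eventually_mono)
      fix z :: real assume z: "0 \<le> z \<and> z < 1"
      then have "a k * z ^ k \<le> a k" for k
        using a_nonneg[of k] by (simp add: mult_left_le power_le_one)
      then show "\<phi> (c - c * z) \<le> suminf a"
        using a_sums[of z] z summable_a suminf_le[of "\<lambda>k. a k * z ^ k" a] by (auto simp: sums_iff)
    qed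
    then show "\<phi> 0 \<le> suminf a"
      using tendsto_upperbound[OF lim] by simp
  qed
  then have a_sums1: "(\<lambda>k. a k / \<phi> 0) sums 1"
    using sums_divide[OF summable_sums[OF summable_a], of "\<phi> 0"] pos by simp
  define p where "p = embed_pmf (\<lambda>k. a k / \<phi> 0)"
  have p: "pmf p k = a k / \<phi> 0" for k
    unfolding p_def
  proof (rule pmf_embed_pmf)
    show "0 \<le> a k / \<phi> 0" for k using a_nonneg pos by simp
    show "(\<integral>\<^sup>+ k. ennreal (a k / \<phi> 0) \<partial>count_space UNIV) = 1"
      using a_sums1 a_nonneg pos
      by (simp add: nn_integral_count_space_nat suminf_ennreal2 sums_iff)
  qed
  show thesis
  proof (rule that)
    fix z :: real assume z: "0 \<le> z" "z < 1"
    have s: "(\<lambda>k. pmf p k * z ^ k) sums (\<phi> (c - c * z) / \<phi> 0)"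
      using sums_divide[OF a_sums[OF z], of "\<phi> 0"] by (simp add: p)
    have "summable (\<lambda>k. pmf p k * \<bar>z ^ k\<bar>)"
      using s z by (simp add: sums_iff)
    from integral_measure_pmf_nat_sums(2)[OF this] s
    have "(\<integral>k. z ^ k \<partial>measure_pmf p) = \<phi> (c - c * z) / \<phi> 0"
      by (rule sums_unique2)
    then show "\<phi> (c - c * z) = \<phi> 0 * (\<integral>k. z ^ k \<partial>measure_pmf p)"
      using pos by simp
  qed
qed

text \<open>
  Feller's argument: substituting \<open>z = exp (- t / N)\<close> into the generating function at \<open>c = N\<close> turns it
  into the Laplace transform of a distribution \<open>\<mu>\<^sub>N\<close> on the lattice of multiples of \<open>1/N\<close>, evaluated
  at \<open>t\<close>; its value is \<open>\<phi>(N (1 - exp (- t / N))) / \<phi>(0)\<close>, which tends to \<open>\<phi>(t) / \<phi>(0)\<close>. Continuity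
  of \<open>\<phi>\<close> at 0 keeps mass from escaping to infinity, so a subsequence of the \<open>\<mu>\<^sub>N\<close> converges weakly.
  Writing \<open>max s 0\<close> for the rate makes the integrand bounded on the whole line and saves recording that
  the limit lives on the half-line.
\<close>

theorem Bernstein_representation:
  assumes bcm: "bounded_completely_monotone \<phi>"
  obtains \<mu> where "real_distribution \<mu>"
    and "\<And>t. 0 \<le> t \<Longrightarrow> \<phi> t = \<phi> 0 * (\<integral>s. exp (- t * max s 0) \<partial>\<mu>)"
proof (cases "\<phi> 0 = 0")
  case True
  have "\<phi> t = 0" if "0 \<le> t" for t
    using bounded_completely_monotone_antimono[OF bcm, of 0 t] bcm that True
    by (auto simp: bounded_completely_monotone_def intro: antisym)
  then show thesis
    using that[OF real_dist_normal_dist] True by simp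
next
  case False
  have cont: "continuous_on {0..} \<phi>"
    using bcm by (auto simp: bounded_completely_monotone_def)
  have "0 \<le> \<phi> 0"
    using bcm by (simp add: bounded_completely_monotone_def)
  with False have pos: "0 < \<phi> 0" by simp
  define N where "N n = real (Suc n)" for n
  have N: "0 < N n" for n by (simp add: N_def)
  have "\<exists>q :: nat pmf. \<forall>z. 0 \<le> z \<longrightarrow> z < 1 \<longrightarrow>
      \<phi> (N n - N n * z) = \<phi> 0 * (\<integral>k. z ^ k \<partial>measure_pmf q)" for n
    by (rule bounded_completely_monotone_Taylor_pmf[OF bcm pos N[of n]]) (rule exI, blast)
  then have "\<exists>p :: nat \<Rightarrow> nat pmf. \<forall>n z. 0 \<le> z \<longrightarrow> z < 1 \<longrightarrow>
      \<phi> (N n - N n * z) = \<phi> 0 * (\<integral>k. z ^ k \<partial>measure_pmf (p n))"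
    by (intro choice allI)
  then obtain p :: "nat \<Rightarrow> nat pmf"
    where p: "\<And>n z. 0 \<le> z \<Longrightarrow> z < 1 \<Longrightarrow>
      \<phi> (N n - N n * z) = \<phi> 0 * (\<integral>k. z ^ k \<partial>measure_pmf (p n))"
    by auto
  define \<mu> where "\<mu> n = distr (measure_pmf (p n)) borel (\<lambda>k. real k / N n)" for n
  have rd: "real_distribution (\<mu> n)" for n
    unfolding \<mu>_def by (intro prob_space.real_distribution_distr measure_pmf.prob_space_axioms) simp
  define \<tau> where "\<tau> t n = N n * (1 - exp (- t / N n))" for t n
  have Laplace: "\<phi> (\<tau> t n) = \<phi> 0 * (\<integral>s. exp (- t * max s 0) \<partial>\<mu> n)" if "0 < t" for t n
  proof -
    have "exp (- t * max (real k / N n) 0) = exp (- t / N n) ^ k" for k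
      using N[of n] by (simp add: exp_of_nat_mult[symmetric] mult_ac)
    then have "(\<integral>s. exp (- t * max s 0) \<partial>\<mu> n) = (\<integral>k. exp (- t / N n) ^ k \<partial>measure_pmf (p n))"
      unfolding \<mu>_def by (subst integral_distr) auto
    then show ?thesis
      using p[of "exp (- t / N n)" n] that N[of n] by (simp add: \<tau>_def right_diff_distrib)
  qed
  have \<tau>_nonneg: "0 \<le> \<tau> t n" and \<tau>_le: "\<tau> t n \<le> t" if "0 < t" for t n
  proof -
    show "0 \<le> \<tau> t n" using that N[of n] by (simp add: \<tau>_def)
    have "1 - exp (- t / N n) \<le> t / N n"
      using exp_ge_add_one_self[of "- t / N n"] by simp
    then show "\<tau> t n \<le> t"
      using N[of n] by (simp add: \<tau>_def field_simps)
  qed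
  have \<tau>_lim: "\<tau> t \<longlonglongrightarrow> t" for t
    unfolding \<tau>_def N_def by real_asymp
  have \<phi>_lim: "(\<lambda>n. \<phi> (\<tau> t n)) \<longlonglongrightarrow> \<phi> t" if "0 < t" for t
    by (rule continuous_on_tendsto_compose[OF cont \<tau>_lim]) (use that \<tau>_nonneg in auto)
  have bdd: "norm (exp (- t * max s 0)) \<le> 1" if "0 < t" for s t :: real
    using that by simp
  \<comment> \<open>A point \<open>s > 1 / t\<close> contributes at least \<open>q = 1 - exp (- 1)\<close> to the integral of
      \<open>1 - exp (- t s)\<close>, which is at most \<open>1 - \<phi>(t) / \<phi>(0)\<close> and hence small for small \<open>t\<close>,
      uniformly in \<open>n\<close>.\<close>
  have tight: "tight \<mu>"
    unfolding tight_def
  proof (intro conjI allI impI rd)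
    fix \<epsilon> :: real assume \<epsilon>: "0 < \<epsilon>"
    define q where "q = 1 - exp (- 1 :: real)"
    have q: "0 < q" by (simp add: q_def)
    have "(\<phi> \<longlongrightarrow> \<phi> 0) (at_right 0)"
      using cont by (auto simp: continuous_on at_within_Ici_at_right dest: bspec[of _ _ 0])
    then have "\<forall>\<^sub>F t in at_right 0. \<phi> 0 * (1 - \<epsilon> * q) < \<phi> t"
      by (rule order_tendstoD) (use pos q \<epsilon> in simp)
    then have "\<forall>\<^sub>F t in at_right 0. \<phi> 0 * (1 - \<epsilon> * q) < \<phi> t \<and> 0 < t"
      by (auto intro: eventually_conj eventually_at_right_less)
    then obtain t where t: "\<phi> 0 * (1 - \<epsilon> * q) < \<phi> t" "0 < t"
      by (auto dest: eventually_happens)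
    have "1 - \<epsilon> < measure (\<mu> n) {-1<..1 / t}" for n
    proof -
      interpret real_distribution "\<mu> n" by (rule rd)
      define L where "L = (\<integral>s. exp (- t * max s 0) \<partial>\<mu> n)"
      have int: "integrable (\<mu> n) (\<lambda>s. exp (- t * max s 0))"
        using bdd[OF t(2)] by (intro integrable_const_bound[where B = 1]) auto
      have "\<phi> 0 * (1 - \<epsilon> * q) < \<phi> 0 * L"
        using t bounded_completely_monotone_antimono[OF bcm \<tau>_nonneg \<tau>_le, of t n]
          Laplace[of t n] by (simp add: L_def)
      then have "1 - L < \<epsilon> * q" using pos by simp
      then have "1 - \<epsilon> < 1 - (1 - L) / q" using q by (simp add: field_simps)
      also have "\<dots> = (\<integral>s. 1 - (1 - exp (- t * max s 0)) / q \<partial>\<mu> n)"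
        using int prob_space by (simp add: L_def)
      also have "\<dots> \<le> (\<integral>s. indicator {-1<..1 / t} s \<partial>\<mu> n)"
      proof (rule integral_mono_AE)
        have *: "1 - (1 - exp (- t * max s 0)) / q \<le> indicator {-1<..1 / t} s"
          if "0 \<le> s" for s
        proof (cases "s \<le> 1 / t")
          case True
          have "0 \<le> (1 - exp (- t * max s 0)) / q" using that t q by simp
          then show ?thesis using True that by simp
        next
          case False
          then have "1 \<le> t * s" using t by (simp add: field_simps)
          then have "q \<le> 1 - exp (- t * max s 0)" using that by (simp add: q_def)
          then show ?thesis using q False by (simp add: field_simps)
        qed
        have "AE s in \<mu> n. 0 \<le> s"
          unfolding \<mu>_def using N[of n] by (subst AE_distr_iff) auto
        then show "AE s in \<mu> n. 1 - (1 - exp (- t * max s 0)) / q \<le> indicator {-1<..1 / t} s"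
          by (rule AE_mp) (use * in auto)
      qed (use int in \<open>auto intro!: integrable_real_indicator simp: less_top[symmetric]\<close>)
      also have "\<dots> = measure (\<mu> n) {-1<..1 / t}"
        by simp
      finally show ?thesis .
    qed
    then show "\<exists>a b. a < b \<and> (\<forall>n. 1 - \<epsilon> < measure (\<mu> n) {a<..b})"
      using t by (intro exI[of _ "-1"] exI[of _ "1 / t"]) (auto intro: less_trans[of _ 0])
  qed
  obtain r M where r: "strict_mono r" and M: "real_distribution M"
    and conv: "weak_conv_m (\<mu> \<circ> id \<circ> r) M"
    using tight_imp_convergent_subsubsequence[OF tight strict_mono_id] by blast
  show thesis
  proof (rule that[OF M])
    fix t :: real assume "0 \<le> t"
    then consider "t = 0" | "0 < t" by linarith
    then show "\<phi> t = \<phi> 0 * (\<integral>s. exp (- t * max s 0) \<partial>M)"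
    proof cases
      case 1
      interpret real_distribution M by (rule M)
      show ?thesis using 1 prob_space by simp
    next
      case 2
      have "(\<lambda>n. integral\<^sup>L ((\<mu> \<circ> id \<circ> r) n) (\<lambda>s. exp (- t * max s 0)))
          \<longlonglongrightarrow> integral\<^sup>L M (\<lambda>s. exp (- t * max s 0))"
      proof (rule weak_conv_imp_integral_bdd_continuous_conv[OF _ M conv])
        show "real_distribution ((\<mu> \<circ> id \<circ> r) n)" for n using rd by simp
        show "isCont (\<lambda>s. exp (- t * max s 0)) x" for x by (intro continuous_intros)
        show "norm (exp (- t * max s 0)) \<le> 1" for s using bdd[OF 2] .
      qed
      then have "(\<lambda>n. \<phi> 0 * (\<integral>s. exp (- t * max s 0) \<partial>\<mu> (r n)))
          \<longlonglongrightarrow> \<phi> 0 * (\<integral>s. exp (- t * max s 0) \<partial>M)"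
        by (intro tendsto_mult_left) simp
      then have "(\<lambda>n. \<phi> (\<tau> t (r n))) \<longlonglongrightarrow> \<phi> 0 * (\<integral>s. exp (- t * max s 0) \<partial>M)"
        using Laplace[OF 2] by simp
      moreover have "(\<lambda>n. \<phi> (\<tau> t (r n))) \<longlonglongrightarrow> \<phi> t"
        using LIMSEQ_subseq_LIMSEQ[OF \<phi>_lim[OF 2] r] by (simp add: o_def)
      ultimately show ?thesis by (rule LIMSEQ_unique[symmetric])
    qed
  qed
qed

lemma deriv_n_shifted_powr:
  assumes "t > 0"
  shows "(deriv ^^ n) (\<lambda>x::real. (1 + x) powr - q) t = (-1) ^ n * pochhammer q n * (1 + t) powr (- q - real n)"
    and "(deriv ^^ n) (\<lambda>x::real. (1 + x) powr - q) field_differentiable (at t)"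
proof -
  let ?f = "\<lambda>x::real. (1 + x) powr - q"
  let ?g = "\<lambda>n t. (-1) ^ n * pochhammer q n * (1 + t) powr (- q - real n)"
  have g: "(?g n has_field_derivative ?g (Suc n) t) (at t)" if "t > 0" for n t
  proof -
    have "((\<lambda>t. (1 + t) powr (- q - real n)) has_field_derivative
        (- q - real n) * (1 + t) powr (- q - real n - 1) * 1) (at t)"
      by (rule DERIV_chain2[OF has_real_derivative_powr])
        (use that in \<open>auto intro!: derivative_eq_intros\<close>)
    from DERIV_cmult[OF this, of "(-1) ^ n * pochhammer q n"] show ?thesis
      by (simp add: pochhammer_Suc algebra_simps diff_diff_eq)
  qed
  have f: "((deriv ^^ n) ?f has_field_derivative ?g (Suc n) t) (at t)"
    if "t > 0" "\<And>t. t > 0 \<Longrightarrow> (deriv ^^ n) ?f t = ?g n t" for n t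
    by (rule has_field_derivative_transform_within_open[OF g, of _ "{0<..}"]) (use that in auto)
  have eq: "t > 0 \<Longrightarrow> (deriv ^^ n) ?f t = ?g n t" for n t
  proof (induction n arbitrary: t)
    case (Suc n)
    then show ?case using DERIV_imp_deriv[OF f[of t n]] by simp
  qed simp
  then show "(deriv ^^ n) ?f t = ?g n t" using assms by blast
  show "(deriv ^^ n) ?f field_differentiable (at t)"
    using f[OF assms eq] by (auto simp: field_differentiable_def)
qed

lemma bounded_completely_monotone_shifted_powr:
  assumes q: "0 \<le> q"
  shows "bounded_completely_monotone (\<lambda>x. (1 + x) powr - q)"
  unfolding bounded_completely_monotone_def completely_monotone_def
proof (intro conjI allI impI)
  fix n and t :: real assume t: "0 < t"
  show "(deriv ^^ n) (\<lambda>x::real. (1 + x) powr - q) field_differentiable (at t)"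
    by (rule deriv_n_shifted_powr[OF t])
  have "0 \<le> pochhammer q n"
    using q by (auto simp: pochhammer_prod intro!: prod_nonneg)
  then show "0 \<le> (- 1) ^ n * (deriv ^^ n) (\<lambda>x::real. (1 + x) powr - q) t"
    by (simp add: deriv_n_shifted_powr(1)[OF t] power_mult_distrib[symmetric] flip: mult.assoc)
next
  have "norm ((1 + x) powr - q) \<le> 1" if "0 < x" for x
    using q that powr_mono[of "- q" 0 "1 + x"] by simp
  then show "bounded ((\<lambda>x. (1 + x) powr - q) ` {0<..})"
    by (auto simp: bounded_iff)
qed (auto intro!: continuous_intros)

section \<open>Kernels as second moments of random functions\<close>

text \<open>
  The random functions \<open>F a\<close> have the kernel \<open>K\<close> as their matrix of uncentred second moments. Uncentred
  moments are the ones that multiply when independent random functions are multiplied.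
\<close>

definition feature_map :: "'w measure \<Rightarrow> ('a \<Rightarrow> 'w \<Rightarrow> real) \<Rightarrow> ('a \<Rightarrow> 'a \<Rightarrow> real) \<Rightarrow> bool" where
  "feature_map M F K \<longleftrightarrow> prob_space M \<and> (\<forall>a. F a \<in> borel_measurable M) \<and>
     (\<forall>a b. has_bochner_integral M (\<lambda>\<omega>. F a \<omega> * F b \<omega>) (K a b))"

lemma feature_mapD:
  assumes "feature_map M F K"
  shows "prob_space M" and "F a \<in> borel_measurable M"
    and "integrable M (\<lambda>\<omega>. F a \<omega> * F b \<omega>)" and "(\<integral>\<omega>. F a \<omega> * F b \<omega> \<partial>M) = K a b"
  using assms by (auto simp: feature_map_def has_bochner_integral_iff)

lemma feature_map_scale:
  assumes "feature_map M F K"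
  shows "feature_map M (\<lambda>a \<omega>. g a * F a \<omega>) (\<lambda>a b. g a * g b * K a b)"
proof -
  have "has_bochner_integral M (\<lambda>\<omega>. (g a * g b) * (F a \<omega> * F b \<omega>)) (g a * g b * K a b)" for a b
    using assms by (intro has_bochner_integral_mult_right) (auto simp: feature_map_def)
  then show ?thesis
    using assms by (auto simp: feature_map_def mult_ac intro!: borel_measurable_times)
qed

lemma feature_map_square_integrable:
  fixes F :: "'a \<Rightarrow> 'w \<Rightarrow> real"
  assumes "prob_space M" and meas: "\<And>a. F a \<in> borel_measurable M"
    and sq: "\<And>a. integrable M (\<lambda>\<omega>. (F a \<omega>)\<^sup>2)"
  shows "feature_map M F (\<lambda>a b. \<integral>\<omega>. F a \<omega> * F b \<omega> \<partial>M)"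
proof -
  have "integrable M (\<lambda>\<omega>. F a \<omega> * F b \<omega>)" for a b
  proof (rule Bochner_Integration.integrable_bound)
    show "integrable M (\<lambda>\<omega>. (F a \<omega>)\<^sup>2 + (F b \<omega>)\<^sup>2)"
      using sq by simp
    show "(\<lambda>\<omega>. F a \<omega> * F b \<omega>) \<in> borel_measurable M"
      using meas by (intro borel_measurable_times)
    have "\<bar>x * y\<bar> \<le> x\<^sup>2 + y\<^sup>2" for x y :: real
      using sum_squares_bound[of "\<bar>x\<bar>" "\<bar>y\<bar>"] mult_nonneg_nonneg[of "\<bar>x\<bar>" "\<bar>y\<bar>"]
      by (simp add: abs_mult del: mult_nonneg_nonneg)
    then show "AE \<omega> in M. norm (F a \<omega> * F b \<omega>) \<le> norm ((F a \<omega>)\<^sup>2 + (F b \<omega>)\<^sup>2)"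
      by simp
  qed
  then show ?thesis
    using assms by (simp add: feature_map_def has_bochner_integral_iff)
qed

text \<open>
  Drawing the parameter \<open>s\<close> at random averages the kernels. Integrability of the diagonal suffices, since
  it bounds the second moments, and these dominate all products.
\<close>

lemma feature_map_mixture:
  fixes F :: "'s \<Rightarrow> 'a \<Rightarrow> 'w \<Rightarrow> real"
  assumes S: "prob_space S"
    and F: "\<And>s. s \<in> space S \<Longrightarrow> feature_map M (F s) (K s)"
    and meas: "\<And>a. (\<lambda>(s, \<omega>). F s a \<omega>) \<in> borel_measurable (S \<Otimes>\<^sub>M M)"
    and diag: "\<And>a. integrable S (\<lambda>s. K s a a)"
  shows "feature_map (S \<Otimes>\<^sub>M M) (\<lambda>a (s, \<omega>). F s a \<omega>) (\<lambda>a b. \<integral>s. K s a b \<partial>S)"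
proof -
  interpret S: prob_space S by fact
  obtain s0 where "s0 \<in> space S" using S.not_empty by blast
  then interpret M: prob_space M using feature_mapD(1)[OF F] by blast
  interpret pair_prob_space S M ..
  let ?F = "\<lambda>a (s, \<omega>). F s a \<omega>"
  have "integrable (S \<Otimes>\<^sub>M M) (\<lambda>p. (?F a p)\<^sup>2)" for a
  proof (rule Fubini_integrable)
    show "(\<lambda>p. (?F a p)\<^sup>2) \<in> borel_measurable (S \<Otimes>\<^sub>M M)"
      by (intro borel_measurable_power meas)
    have "integrable S (\<lambda>s. \<integral>\<omega>. norm ((?F a (s, \<omega>))\<^sup>2) \<partial>M) \<longleftrightarrow> integrable S (\<lambda>s. K s a a)"
      using feature_mapD(4)[OF F, of _ a a]
      by (intro Bochner_Integration.integrable_cong) (auto simp: power2_eq_square)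
    then show "integrable S (\<lambda>s. \<integral>\<omega>. norm ((?F a (s, \<omega>))\<^sup>2) \<partial>M)"
      using diag by simp
    show "AE s in S. integrable M (\<lambda>\<omega>. (?F a (s, \<omega>))\<^sup>2)"
      using feature_mapD(3)[OF F, of _ a a] by (auto simp: power2_eq_square)
  qed
  then have fm: "feature_map (S \<Otimes>\<^sub>M M) ?F (\<lambda>a b. \<integral>p. ?F a p * ?F b p \<partial>(S \<Otimes>\<^sub>M M))"
    by (rule feature_map_square_integrable[OF prob_space_axioms meas])
  have "(\<integral>p. ?F a p * ?F b p \<partial>(S \<Otimes>\<^sub>M M)) = (\<integral>s. K s a b \<partial>S)" for a b
  proof -
    have "(\<integral>p. ?F a p * ?F b p \<partial>(S \<Otimes>\<^sub>M M)) = (\<integral>s. \<integral>\<omega>. F s a \<omega> * F s b \<omega> \<partial>M \<partial>S)"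
      using integral_fst'[OF feature_mapD(3)[OF fm, of a b]] by simp
    also have "\<dots> = (\<integral>s. K s a b \<partial>S)"
      using feature_mapD(4)[OF F] by (intro Bochner_Integration.integral_cong) auto
    finally show ?thesis .
  qed
  then show ?thesis using fm by simp
qed

lemma feature_map_product:
  assumes F: "feature_map M F K" and G: "feature_map N G L"
  shows "feature_map (M \<Otimes>\<^sub>M N) (\<lambda>a (x, y). F a x * G a y) (\<lambda>a b. K a b * L a b)"
proof -
  note [measurable] = feature_mapD(2)[OF F] feature_mapD(2)[OF G]
  have "feature_map (M \<Otimes>\<^sub>M N) (\<lambda>a (x, y). F a x * G a y)
      (\<lambda>a b. \<integral>x. F a x * F b x * L a b \<partial>M)"
    by (rule feature_map_mixture[OF feature_mapD(1)[OF F] feature_map_scale[OF G]])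
       (use feature_mapD(3)[OF F] in auto)
  then show ?thesis
    using feature_mapD(4)[OF F] by simp
qed

lemma feature_map_iid_power:
  assumes F: "feature_map M F K"
  shows "feature_map (Pi\<^sub>M (UNIV :: nat set) (\<lambda>_. M)) (\<lambda>a w. \<Prod>k<n. F a (w k)) (\<lambda>a b. K a b ^ n)"
proof -
  interpret M: prob_space M using feature_mapD(1)[OF F] .
  interpret product_prob_space "\<lambda>_. M" "UNIV :: nat set" ..
  note [measurable] = feature_mapD(2)[OF F]
  have restrict: "(\<lambda>w. restrict w {..<n}) \<in> measurable (Pi\<^sub>M UNIV (\<lambda>_. M)) (Pi\<^sub>M {..<n} (\<lambda>_. M))"
    by (rule measurable_restrict_subset) simp
  have "has_bochner_integral (Pi\<^sub>M {..<n} (\<lambda>_. M)) (\<lambda>w. \<Prod>k<n. F a (w k) * F b (w k)) (K a b ^ n)" for a b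
    using product_integrable_prod[of "{..<n}" "\<lambda>_ x. F a x * F b x"]
      product_integral_prod[of "{..<n}" "\<lambda>_ x. F a x * F b x"] feature_mapD(3,4)[OF F]
    by (simp add: has_bochner_integral_iff)
  then have *: "has_bochner_integral (distr (Pi\<^sub>M UNIV (\<lambda>_. M)) (Pi\<^sub>M {..<n} (\<lambda>_. M)) (\<lambda>w. restrict w {..<n}))
      (\<lambda>w. \<Prod>k<n. F a (w k) * F b (w k)) (K a b ^ n)" for a b
    by (subst distr_PiM_restrict_finite) auto
  have "has_bochner_integral (Pi\<^sub>M UNIV (\<lambda>_. M)) (\<lambda>w. \<Prod>k<n. F a (w k) * F b (w k)) (K a b ^ n)" for a b
    using *[of a b] restrict
    by (simp add: has_bochner_integral_iff integrable_distr_eq integral_distr)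
  then show ?thesis
    using prob_space_axioms by (simp add: feature_map_def prod.distrib)
qed

text \<open>
  A product of \<open>n\<close> independent copies realises \<open>K ^ n\<close>; with \<open>n\<close> Poisson of rate 1 the
  mixture is the exponential series, up to the constant \<open>exp (- 1)\<close>, which the factor
  \<open>exp (1 / 2)\<close> removes.
\<close>

lemma feature_map_exp:
  assumes F: "feature_map M F K"
  shows "feature_map (measure_pmf (poisson_pmf 1) \<Otimes>\<^sub>M Pi\<^sub>M (UNIV :: nat set) (\<lambda>_. M))
    (\<lambda>a (n, w). exp (1 / 2) * (\<Prod>k<n. F a (w k))) (\<lambda>a b. exp (K a b))"
proof -
  interpret M: prob_space M using feature_mapD(1)[OF F] .
  note [measurable] = feature_mapD(2)[OF F]
  let ?p = "poisson_pmf 1"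
  have pmf_power: "pmf ?p n * x ^ n = exp (- 1) * (x ^ n /\<^sub>R fact n)" for x :: real and n
    by (simp add: field_simps)
  have sums: "(\<lambda>n. pmf ?p n * x ^ n) sums (exp (- 1) * exp x)" for x :: real
    unfolding pmf_power by (intro sums_mult exp_converges)
  have summ: "summable (\<lambda>n. pmf ?p n * \<bar>x ^ n\<bar>)" for x :: real
    using sums[of "\<bar>x\<bar>"] by (simp add: sums_iff power_abs)
  have int: "(\<integral>n. x ^ n \<partial>measure_pmf ?p) = exp (- 1) * exp x" for x :: real
    using integral_measure_pmf_nat_sums(2)[OF summ] sums by (rule sums_unique2)
  have meas: "(\<lambda>(n, w). \<Prod>k<n. F a (w k)) \<in>
      borel_measurable (measure_pmf ?p \<Otimes>\<^sub>M Pi\<^sub>M UNIV (\<lambda>_. M))" for a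
    unfolding case_prod_beta
    by (rule measurable_compose_countable[where g = fst]) auto
  have "feature_map (measure_pmf ?p \<Otimes>\<^sub>M Pi\<^sub>M UNIV (\<lambda>_. M)) (\<lambda>a (n, w). \<Prod>k<n. F a (w k))
      (\<lambda>a b. \<integral>n. K a b ^ n \<partial>measure_pmf ?p)"
    using meas integral_measure_pmf_nat_sums(1)[OF summ]
    by (intro feature_map_mixture feature_map_iid_power[OF F] measure_pmf.prob_space_axioms) auto
  from feature_map_scale[OF this, of "\<lambda>_. exp (1 / 2)"] show ?thesis
    by (simp add: int case_prod_unfold exp_add[symmetric])
qed

text \<open>
  Expanding the squared distance splits off factors \<open>exp (- V * K a a / 2)\<close> that depend on one index only;
  they can be absorbed into the random functions, which leaves the exponential of \<open>V * K\<close>.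
\<close>

lemma feature_map_exp_neg_distance:
  assumes F: "feature_map M F K" and V: "0 \<le> V"
  shows "feature_map (measure_pmf (poisson_pmf 1) \<Otimes>\<^sub>M Pi\<^sub>M (UNIV :: nat set) (\<lambda>_. M))
    (\<lambda>a (n, w). exp (- V * K a a / 2) * (exp (1 / 2) * (\<Prod>k<n. sqrt V * F a (w k))))
    (\<lambda>a b. exp (- V * ((K a a + K b b - 2 * K a b) / 2)))"
proof -
  have eq: "exp (- V * K a a / 2) * exp (- V * K b b / 2) * exp (sqrt V * sqrt V * K a b)
      = exp (- V * ((K a a + K b b - 2 * K a b) / 2))" for a b
    using V by (simp add: exp_add[symmetric] algebra_simps add_divide_distrib diff_divide_distrib)
  show ?thesis
    using feature_map_scale[OF feature_map_exp[OF feature_map_scale[OF F, of "\<lambda>_. sqrt V"]],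
        of "\<lambda>a. exp (- V * K a a / 2)"]
    unfolding eq by (simp add: case_prod_unfold)
qed

text \<open>
  This is the addition theorem for the cosine: a fair coin chooses between cosine and sine.
\<close>

lemma feature_map_random_phase:
  "feature_map (measure_pmf (pmf_of_set (UNIV :: bool set)))
    (\<lambda>a b. sqrt 2 * (if b then cos (\<theta> a) else sin (\<theta> a))) (\<lambda>a a'. cos (\<theta> a - \<theta> a'))"
proof -
  have two: "sqrt 2 * x * (sqrt 2 * y) = x * y * 2" for x y
    using real_sqrt_mult_self[of 2] by (simp add: mult_ac flip: mult.assoc)
  show ?thesis
    unfolding feature_map_def has_bochner_integral_iff
    by (auto simp: two integral_pmf_of_set integrable_measure_pmf_finite measure_pmf.prob_space_axioms
        UNIV_bool cos_diff)
qed

section \<open>Random fields with a prescribed covariance\<close>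

lemma feature_map_random_sign:
  "feature_map (measure_pmf (pmf_of_set {-1, 1 :: real})) (\<lambda>_ e. e) (\<lambda>_ _. 1)"
  unfolding feature_map_def has_bochner_integral_iff
  by (auto simp: integral_pmf_of_set integrable_measure_pmf_finite measure_pmf.prob_space_axioms)

text \<open>
  Multiplication by an independent random sign leaves all second moments unchanged and makes the field
  centred, so that second moments become covariances.
\<close>

lemma matrix_covariance_function_feature_map:
  fixes C :: "'p::euclidean_space \<Rightarrow> real ^ 'm ^ 'm"
  assumes F: "feature_map M F (\<lambda>(x, i) (y, j). C (x - y) $ i $ j)"
  shows "matrix_covariance_function C"
proof -
  let ?K = "\<lambda>(x, i) (y, j). C (x - y) $ i $ j"
  let ?E = "measure_pmf (pmf_of_set {-1, 1 :: real})"
  define N where "N = ?E \<Otimes>\<^sub>M M"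
  define H where "H = (\<lambda>a (e, \<omega>). e * F a \<omega>)"
  have H: "feature_map N H ?K"
    using feature_map_product[OF feature_map_random_sign F] by (simp add: N_def H_def case_prod_unfold)
  interpret M: prob_space M using feature_mapD(1)[OF F] .
  interpret N: prob_space N using feature_mapD(1)[OF H] .
  interpret EM: pair_prob_space ?E M
    by (intro pair_prob_space.intro pair_sigma_finite.intro measure_pmf.sigma_finite_measure_axioms
        M.sigma_finite_measure_axioms measure_pmf.prob_space_axioms M.prob_space_axioms)
  have int: "integrable N (H a)" for a
    using feature_mapD(3)[OF H, of a a]
    by (intro N.square_integrable_imp_integrable[OF feature_mapD(2)[OF H]]) (simp add: power2_eq_square)
  have mean: "(\<integral>\<omega>. H a \<omega> \<partial>N) = 0" for a
  proof -
    have "(\<integral>\<omega>. H a \<omega> \<partial>N) = (\<integral>e. \<integral>\<omega>. e * F a \<omega> \<partial>M \<partial>?E)"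
      using EM.integral_fst'[OF int[of a, unfolded N_def]] by (simp add: N_def H_def)
    also have "\<dots> = 0" by (simp add: integral_pmf_of_set)
    finally show ?thesis .
  qed
  define Z :: "'p \<Rightarrow> _ \<Rightarrow> real ^ 'm" where "Z x \<omega> = (\<chi> i. H (x, i) \<omega>)" for x \<omega>
  have Z: "Z x = (\<lambda>\<omega>. \<Sum>i\<in>UNIV. H (x, i) \<omega> *\<^sub>R axis i 1)" for x
    by (auto simp: Z_def vec_eq_iff axis_def if_distrib cong: if_cong)
  have intZ: "integrable N (Z x)" for x
    unfolding Z using int by (intro Bochner_Integration.integrable_sum integrable_scaleR_left) auto
  have meanZ: "(\<integral>\<omega>. Z x \<omega> \<partial>N) = 0" for x
    unfolding Z using int mean by (subst Bochner_Integration.integral_sum) auto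
  have nth: "(\<lambda>\<omega>. Z x \<omega> $ i) = H (x, i)" for x i by (simp add: Z_def)
  have cov: "covariance_exists N (H (x, i)) (H (y, j))"
    "covariance N (H (x, i)) (H (y, j)) = C (x - y) $ i $ j" for x y i j
    using feature_mapD(3,4)[OF H] int mean
    by (auto simp: covariance_exists_def covariance_def)
  have "covariance_function_of N Z C"
    unfolding covariance_function_of_def second_order_stationary_def random_field_def nth
    using cov intZ meanZ N.prob_space_axioms borel_measurable_integrable[OF intZ] by auto
  then show ?thesis by (rule matrix_covariance_functionI)
qed

section \<open>Pseudo-variograms as squared distances\<close>

text \<open>
  The field itself need not have moments, but its increments against one fixed component at the
  origin do. Differences of these centred increments are the centred differences of the field, whose
  second moments the pseudo-variogram records.
\<close>

lemma pseudo_variogram_feature_map: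
  fixes Z :: "'p::euclidean_space \<Rightarrow> 'w \<Rightarrow> real ^ 'm"
  assumes "pseudo_variogram_of M Z \<gamma>"
  obtains Y K where "feature_map M Y K"
    and "\<And>s t i j. \<gamma> (s - t) $ i $ j
      = (K (s, i) (s, i) + K (t, j) (t, j) - 2 * K (s, i) (t, j)) / 2"
proof -
  \<comment> \<open>Any component at the origin serves as the common reference.\<close>
  define i0 :: 'm where "i0 = undefined"
  have "random_field M Z"
    using assms by (auto simp: pseudo_variogram_of_def intrinsically_stationary_def)
  then interpret prob_space M by (simp add: random_field_def)
  have Zm: "(\<lambda>\<omega>. Z x \<omega> $ i) \<in> borel_measurable M" for x i
    using \<open>random_field M Z\<close> unfolding random_field_def
    by (intro measurable_compose[OF _ borel_measurable_continuous_onI[of "\<lambda>v. v $ i"]] continuous_intros) auto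
  have sq: "integrable M (\<lambda>\<omega>. (Z (t + u) \<omega> $ i - Z t \<omega> $ j)\<^sup>2)" for t u i j
    using assms by (auto simp: pseudo_variogram_of_def)
  define D where "D a \<omega> = Z (fst a) \<omega> $ snd a - Z 0 \<omega> $ i0" for a \<omega>
  have Dm: "D a \<in> borel_measurable M" for a
    unfolding D_def using Zm by (intro borel_measurable_diff)
  have D2: "integrable M (\<lambda>\<omega>. (D a \<omega>)\<^sup>2)" for a
    using sq[of 0 "fst a" "snd a" i0] by (simp add: D_def)
  have D1: "integrable M (D a)" for a
    by (rule square_integrable_imp_integrable[OF Dm D2])
  define Y where "Y a \<omega> = D a \<omega> - expectation (D a)" for a \<omega>
  define K where "K a b = expectation (\<lambda>\<omega>. Y a \<omega> * Y b \<omega>)" for a b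
  have Y: "feature_map M Y K"
    unfolding K_def
  proof (rule feature_map_square_integrable[OF prob_space_axioms])
    show "Y a \<in> borel_measurable M" for a
      unfolding Y_def using Dm by (intro borel_measurable_diff) auto
    show "integrable M (\<lambda>\<omega>. (Y a \<omega>)\<^sup>2)" for a
      unfolding Y_def power2_diff using D1 D2 by simp
  qed
  show thesis
  proof (rule that[OF Y])
    fix s t :: 'p and i j :: 'm
    have X: "Z s \<omega> $ i - Z t \<omega> $ j = D (s, i) \<omega> - D (t, j) \<omega>" for \<omega>
      by (simp add: D_def)
    have "\<gamma> (s - t) $ i $ j = 1 / 2 * variance (\<lambda>\<omega>. Z (t + (s - t)) \<omega> $ i - Z t \<omega> $ j)"
      using assms unfolding pseudo_variogram_of_def by blast
    also have "variance (\<lambda>\<omega>. Z (t + (s - t)) \<omega> $ i - Z t \<omega> $ j)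
        = expectation (\<lambda>\<omega>. Y (s, i) \<omega> * Y (s, i) \<omega> + Y (t, j) \<omega> * Y (t, j) \<omega> - 2 * (Y (s, i) \<omega> * Y (t, j) \<omega>))"
      using D1 by (simp add: X Y_def power2_eq_square algebra_simps)
    also have "\<dots> = K (s, i) (s, i) + K (t, j) (t, j) - 2 * K (s, i) (t, j)"
      using feature_mapD(3)[OF Y] by (simp add: K_def)
    finally show "\<gamma> (s - t) $ i $ j
        = (K (s, i) (s, i) + K (t, j) (t, j) - 2 * K (s, i) (t, j)) / 2" by simp
  qed
qed

section \<open>Damped Gaussian Fourier integrals\<close>

abbreviation gauss_vector :: "('d \<Rightarrow> real) measure" where
  "gauss_vector \<equiv> Pi\<^sub>M UNIV (\<lambda>_. std_normal_distribution)"

text \<open>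
  The damping factor turns the standard normal density at \<open>x\<close> into the one at \<open>\<surd>(1 + g) x\<close>, so a linear
  substitution reduces the integral to the characteristic function of the normal law.
\<close>

lemma std_normal_damped_char:
  assumes g: "0 \<le> g"
  shows "has_bochner_integral std_normal_distribution
    (\<lambda>x. complex_of_real (exp (- g * x\<^sup>2 / 2)) * iexp (c * x))
    (complex_of_real ((1 + g) powr (- 1 / 2) * exp (- (c\<^sup>2 / (2 * (1 + g))))))"
proof -
  define a where "a = sqrt (1 + g)"
  have a: "0 < a" "a\<^sup>2 = 1 + g" using g by (auto simp: a_def)
  interpret real_distribution std_normal_distribution by (rule real_dist_normal_dist)
  let ?f = "\<lambda>x. complex_of_real (exp (- g * x\<^sup>2 / 2)) * iexp (c * x)"
  have "integrable std_normal_distribution ?f"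
    by (rule integrable_const_bound[where B = 1]) (use g in \<open>auto simp: norm_mult\<close>)
  moreover have "integral\<^sup>L std_normal_distribution ?f
      = complex_of_real ((1 + g) powr (- 1 / 2) * exp (- (c\<^sup>2 / (2 * (1 + g)))))"
  proof -
    have dens: "std_normal_density (a * x) = std_normal_density x * exp (- g * x\<^sup>2 / 2)" for x
    proof -
      have "- (a * x)\<^sup>2 / 2 = - x\<^sup>2 / 2 + - g * x\<^sup>2 / 2"
        unfolding power_mult_distrib a by (simp add: field_simps)
      then show ?thesis
        by (simp add: std_normal_density_def exp_add[symmetric])
    qed
    have "complex_of_real (exp (- ((c / a)\<^sup>2) / 2)) = char std_normal_distribution (c / a)"
      by (simp add: char_std_normal_distribution)
    also have "\<dots> = (\<integral>x. std_normal_density x *\<^sub>R iexp (c / a * x) \<partial>lborel)"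
      unfolding char_def by (subst integral_density) auto
    also have "\<dots> = a *\<^sub>R (\<integral>x. std_normal_density (a * x) *\<^sub>R iexp (c / a * (a * x)) \<partial>lborel)"
      using a by (subst lborel_integral_real_affine[where c = a and t = 0]) auto
    also have "\<dots> = a *\<^sub>R (\<integral>x. std_normal_density x *\<^sub>R ?f x \<partial>lborel)"
      unfolding dens using a by (simp add: scaleR_conv_of_real mult_ac)
    also have "\<dots> = a *\<^sub>R integral\<^sup>L std_normal_distribution ?f"
      by (subst integral_density) auto
    finally have "integral\<^sup>L std_normal_distribution ?f = complex_of_real (exp (- ((c / a)\<^sup>2) / 2) / a)"
      using a by (simp add: scaleR_conv_of_real field_simps)
    also have "exp (- ((c / a)\<^sup>2) / 2) / a = 1 / a * exp (- (c\<^sup>2 / (2 * (1 + g))))"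
      unfolding power_divide a(2) by simp
    also have "1 / a = (1 + g) powr (- 1 / 2)"
      using g by (simp add: a_def powr_minus_divide powr_half_sqrt)
    finally show ?thesis .
  qed
  ultimately show ?thesis by (simp add: has_bochner_integral_iff)
qed

lemma std_normal_vector_damped_cos:
  fixes h :: "real ^ 'd"
  assumes g: "0 \<le> g"
  shows "(\<integral>x. exp (- g * (\<Sum>k\<in>UNIV. (x k)\<^sup>2) / 2) * cos (c * (\<Sum>k\<in>UNIV. h $ k * x k))
      \<partial>gauss_vector)
    = (1 + g) powr (- real CARD('d) / 2) * exp (- (c\<^sup>2 * (norm h)\<^sup>2 / (2 * (1 + g))))"
proof -
  interpret real_distribution std_normal_distribution by (rule real_dist_normal_dist)
  interpret product_prob_space "\<lambda>_. std_normal_distribution" "UNIV :: 'd set" ..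
  let ?P = "gauss_vector :: ('d \<Rightarrow> real) measure"
  let ?f = "\<lambda>k x. complex_of_real (exp (- g * x\<^sup>2 / 2)) * iexp (c * h $ k * x)"
  have f: "integrable std_normal_distribution (?f k)"
    "(\<integral>x. ?f k x \<partial>std_normal_distribution)
      = complex_of_real ((1 + g) powr (- 1 / 2) * exp (- ((c * h $ k)\<^sup>2 / (2 * (1 + g)))))" for k
    using std_normal_damped_char[OF g, of "c * h $ k"] unfolding has_bochner_integral_iff by blast+
  have Re: "exp (- g * (\<Sum>k\<in>UNIV. (x k)\<^sup>2) / 2) * cos (c * (\<Sum>k\<in>UNIV. h $ k * x k))
      = Re (\<Prod>k\<in>UNIV. ?f k (x k))" for x
  proof -
    have "(\<Prod>k\<in>UNIV. ?f k (x k)) = complex_of_real (\<Prod>k\<in>UNIV. exp (- g * (x k)\<^sup>2 / 2)) *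
        (\<Prod>k\<in>UNIV. iexp (c * h $ k * x k))"
      by (simp add: prod.distrib)
    also have "(\<Prod>k\<in>UNIV. exp (- g * (x k)\<^sup>2 / 2)) = exp (- g * (\<Sum>k\<in>UNIV. (x k)\<^sup>2) / 2)"
      by (simp add: exp_sum[symmetric] sum_distrib_left sum_divide_distrib sum_negf)
    also have "(\<Prod>k\<in>UNIV. iexp (c * h $ k * x k)) = iexp (c * (\<Sum>k\<in>UNIV. h $ k * x k))"
      by (simp add: exp_sum[symmetric] sum_distrib_left mult_ac)
    finally show ?thesis by (simp add: Re_exp)
  qed
  have "(\<integral>x. (\<Prod>k\<in>UNIV. ?f k (x k)) \<partial>?P)
      = (\<Prod>k\<in>UNIV. complex_of_real ((1 + g) powr (- 1 / 2) * exp (- ((c * h $ k)\<^sup>2 / (2 * (1 + g))))))"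
    using f by (subst product_integral_prod) (simp_all only: finite)
  also have "\<dots> = complex_of_real (((1 + g) powr (- 1 / 2)) ^ CARD('d) *
      exp (\<Sum>k\<in>UNIV. - ((c * h $ k)\<^sup>2 / (2 * (1 + g)))))"
    by (simp add: prod.distrib exp_sum)
  also have "((1 + g) powr (- 1 / 2)) ^ CARD('d) = (1 + g) powr (- real CARD('d) / 2)"
    using g by (simp add: powr_power)
  also have "(\<Sum>k\<in>UNIV. - ((c * h $ k)\<^sup>2 / (2 * (1 + g)))) = - (c\<^sup>2 * (norm h)\<^sup>2 / (2 * (1 + g)))"
    by (simp add: norm_vec_def L2_set_def sum_nonneg sum_negf sum_divide_distrib
        power_mult_distrib sum_distrib_left)
  finally have *: "(\<integral>x. (\<Prod>k\<in>UNIV. ?f k (x k)) \<partial>?P) = complex_of_real ((1 + g) powr (- real CARD('d) / 2) *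
      exp (- (c\<^sup>2 * (norm h)\<^sup>2 / (2 * (1 + g)))))" .
  have "integrable ?P (\<lambda>x. \<Prod>k\<in>UNIV. ?f k (x k))"
    using f by (intro product_integrable_prod) (simp_all only: finite)
  then show ?thesis
    unfolding Re by (simp only: integral_Re * Re_complex_of_real)
qed

section \<open>The mixture and its kernel\<close>

text \<open>
  In the triple \<open>(s, t, x)\<close>, \<open>s\<close> is the Bernstein variable of \<open>\<phi>\<close>, \<open>t\<close> that of
  \<open>y \<mapsto> (1 + y) powr - q\<close>, and \<open>x\<close> a random frequency. The frequency also enters the rate, which
  couples the damping by the pseudo-variogram to the spatial oscillation.
\<close>

definition mixing_rate :: "real \<times> real \<times> ('d::finite \<Rightarrow> real) \<Rightarrow> real" where
  "mixing_rate = (\<lambda>(s, t, x). max t 0 + (\<Sum>k\<in>UNIV. (x k)\<^sup>2) / 2)"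

definition mixing_phase :: "real \<times> real \<times> ('d::finite \<Rightarrow> real) \<Rightarrow> real ^ 'd \<Rightarrow> real" where
  "mixing_phase = (\<lambda>(s, t, x) h. sqrt (2 * max s 0) * (\<Sum>k\<in>UNIV. h $ k * x k))"

lemma mixing_rate_nonneg: "0 \<le> mixing_rate p"
  by (auto simp: mixing_rate_def case_prod_unfold intro!: add_nonneg_nonneg sum_nonneg)

lemma mixing_rate_measurable:
  assumes "real_distribution \<mu>" "real_distribution \<nu>"
  shows "mixing_rate \<in> borel_measurable (\<mu> \<Otimes>\<^sub>M \<nu> \<Otimes>\<^sub>M gauss_vector)"
proof -
  interpret \<mu>: real_distribution \<mu> by fact
  interpret \<nu>: real_distribution \<nu> by fact
  show ?thesis unfolding mixing_rate_def by measurable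
qed

lemma mixing_phase_measurable:
  assumes "real_distribution \<mu>" "real_distribution \<nu>"
  shows "(\<lambda>p. mixing_phase p h) \<in> borel_measurable (\<mu> \<Otimes>\<^sub>M \<nu> \<Otimes>\<^sub>M gauss_vector)"
proof -
  interpret \<mu>: real_distribution \<mu> by fact
  interpret \<nu>: real_distribution \<nu> by fact
  show ?thesis unfolding mixing_phase_def case_prod_unfold by measurable
qed

text \<open>
  Given \<open>s\<close> and \<open>t\<close>, the integral over \<open>x\<close> is a damped Gaussian Fourier integral; afterwards the
  integrals over \<open>s\<close> and \<open>t\<close> separate.
\<close>

lemma mixing_integral:
  fixes h h' :: "real ^ 'd"
  assumes \<mu>: "real_distribution \<mu>" and \<nu>: "real_distribution \<nu>" and g: "0 \<le> g"
  shows "(\<integral>p. cos (mixing_phase p h - mixing_phase p h') * exp (- mixing_rate p * g)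
      \<partial>(\<mu> \<Otimes>\<^sub>M \<nu> \<Otimes>\<^sub>M gauss_vector))
    = (1 + g) powr (- real CARD('d) / 2)
      * (\<integral>s. exp (- ((norm (h - h'))\<^sup>2 / (1 + g)) * max s 0) \<partial>\<mu>)
      * (\<integral>t. exp (- g * max t 0) \<partial>\<nu>)"
proof -
  let ?P = "gauss_vector :: ('d \<Rightarrow> real) measure"
  let ?S = "\<mu> \<Otimes>\<^sub>M \<nu> \<Otimes>\<^sub>M ?P"
  interpret \<mu>: real_distribution \<mu> by (rule \<mu>)
  interpret \<nu>: real_distribution \<nu> by (rule \<nu>)
  interpret N: real_distribution std_normal_distribution by (rule real_dist_normal_dist)
  interpret P: product_prob_space "\<lambda>_. std_normal_distribution" "UNIV :: 'd set" ..
  interpret \<nu>P: pair_prob_space \<nu> ?P ..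
  interpret S: pair_prob_space \<mu> "\<nu> \<Otimes>\<^sub>M ?P" ..
  let ?n = "(norm (h - h'))\<^sup>2 / (1 + g)"
  let ?f = "\<lambda>p. cos (mixing_phase p h - mixing_phase p h') * exp (- mixing_rate p * g)"
  have bound: "norm (?f p) \<le> 1" for p
    using g mixing_rate_nonneg[of p] by (auto simp: abs_mult intro!: mult_le_one)
  have int: "integrable ?S ?f"
  proof (rule S.integrable_const_bound)
    show "AE p in ?S. norm (?f p) \<le> 1" using bound by (rule AE_I2)
    show "?f \<in> borel_measurable ?S"
      using mixing_rate_measurable[OF \<mu> \<nu>] mixing_phase_measurable[OF \<mu> \<nu>] by measurable
  qed
  have inner: "(\<integral>x. ?f (s, t, x) \<partial>?P)
      = (1 + g) powr (- real CARD('d) / 2) * exp (- ?n * max s 0) * exp (- g * max t 0)" for s t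
  proof -
    have "?f (s, t, x) = exp (- g * max t 0) * (exp (- g * (\<Sum>k\<in>UNIV. (x k)\<^sup>2) / 2) *
        cos (sqrt (2 * max s 0) * (\<Sum>k\<in>UNIV. (h - h') $ k * x k)))" for x
      by (simp add: mixing_rate_def mixing_phase_def exp_add[symmetric] algebra_simps sum_subtractf add_divide_distrib)
    then have "(\<integral>x. ?f (s, t, x) \<partial>?P) = exp (- g * max t 0) * ((1 + g) powr (- real CARD('d) / 2) *
        exp (- ((sqrt (2 * max s 0))\<^sup>2 * (norm (h - h'))\<^sup>2 / (2 * (1 + g)))))"
      using std_normal_vector_damped_cos[OF g, of "sqrt (2 * max s 0)" "h - h'"] by simp
    also have "(sqrt (2 * max s 0))\<^sup>2 * (norm (h - h'))\<^sup>2 / (2 * (1 + g)) = ?n * max s 0"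
      using g by (simp add: field_simps)
    finally show ?thesis by (simp only: mult_minus_left mult_minus_right mult_ac)
  qed
  have "(\<integral>p. ?f p \<partial>?S) = (\<integral>s. \<integral>z. ?f (s, z) \<partial>(\<nu> \<Otimes>\<^sub>M ?P) \<partial>\<mu>)"
    using S.integral_fst'[OF int] by simp
  also have "\<dots> = (\<integral>s. \<integral>t. \<integral>x. ?f (s, t, x) \<partial>?P \<partial>\<nu> \<partial>\<mu>)"
  proof (rule Bochner_Integration.integral_cong[OF refl])
    fix s assume s: "s \<in> space \<mu>"
    have "integrable (\<nu> \<Otimes>\<^sub>M ?P) (\<lambda>z. ?f (s, z))"
    proof (rule \<nu>P.integrable_const_bound)
      show "AE z in \<nu> \<Otimes>\<^sub>M ?P. norm (?f (s, z)) \<le> 1" using bound by (rule AE_I2)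
      show "(\<lambda>z. ?f (s, z)) \<in> borel_measurable (\<nu> \<Otimes>\<^sub>M ?P)"
        using measurable_compose[OF measurable_Pair1'[OF s] borel_measurable_integrable[OF int]] .
    qed
    from \<nu>P.integral_fst'[OF this]
    show "(\<integral>z. ?f (s, z) \<partial>(\<nu> \<Otimes>\<^sub>M ?P)) = (\<integral>t. \<integral>x. ?f (s, t, x) \<partial>?P \<partial>\<nu>)" by simp
  qed
  also have "\<dots> = (1 + g) powr (- real CARD('d) / 2) * (\<integral>s. exp (- ?n * max s 0) \<partial>\<mu>)
      * (\<integral>t. exp (- g * max t 0) \<partial>\<nu>)"
    unfolding inner by (simp only: integral_mult_right_zero integral_mult_left_zero)
  finally show ?thesis by (simp only: mult_ac)
qed

theorem corollary4p2:
  fixes M :: "'w measure"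
    and Z :: "real ^ 'l \<Rightarrow> 'w \<Rightarrow> real ^ 'm"
    and \<gamma> :: "real ^ 'l \<Rightarrow> real ^ 'm ^ 'm"
    and \<phi> :: "real \<Rightarrow> real"
    and r :: real
    and G :: "(real ^ 'd) \<times> (real ^ 'l) \<Rightarrow> real ^ 'm ^ 'm"
  assumes "pseudo_variogram_of M Z \<gamma>"
    and "bounded_completely_monotone \<phi>"
    and "r \<ge> real CARD('d) / 2"
    and "\<And>h u i j. G (h, u) $ i $ j =
           1 / (1 + \<gamma> u $ i $ j) powr r * \<phi> ((norm h)\<^sup>2 / (1 + \<gamma> u $ i $ j))"
  shows "matrix_covariance_function G \<and> (\<phi> 0 = 1 \<longrightarrow> matrix_correlation_function G)"
proof -
  define q where "q = r - real CARD('d) / 2"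
  have q: "0 \<le> q" using assms(3) by (simp add: q_def)
  obtain \<mu> where \<mu>: "real_distribution \<mu>"
    and \<phi>: "\<And>t. 0 \<le> t \<Longrightarrow> \<phi> t = \<phi> 0 * (\<integral>s. exp (- t * max s 0) \<partial>\<mu>)"
    using Bernstein_representation[OF assms(2)] by blast
  obtain \<nu> where \<nu>: "real_distribution \<nu>"
    and \<nu>_eq: "\<And>g. 0 \<le> g \<Longrightarrow> (1 + g) powr - q = (\<integral>t. exp (- g * max t 0) \<partial>\<nu>)"
    using Bernstein_representation[OF bounded_completely_monotone_shifted_powr[OF q]] by auto
  obtain Y K where Y: "feature_map M Y K"
    and \<gamma>: "\<And>s t i j. \<gamma> (s - t) $ i $ j = (K (s, i) (s, i) + K (t, j) (t, j) - 2 * K (s, i) (t, j)) / 2"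
    using pseudo_variogram_feature_map[OF assms(1)] by blast
  have \<phi>0: "0 \<le> \<phi> 0"
    using assms(2) by (simp add: bounded_completely_monotone_def)
  have \<gamma>_nonneg: "0 \<le> \<gamma> u $ i $ j" for u i j
  proof -
    have "\<gamma> u $ i $ j = 1 / 2 * prob_space.variance M (\<lambda>\<omega>. Z (0 + u) \<omega> $ i - Z 0 \<omega> $ j)"
      using assms(1) unfolding pseudo_variogram_of_def by blast
    also have "0 \<le> \<dots>" by (intro mult_nonneg_nonneg Bochner_Integration.integral_nonneg) auto
    finally show ?thesis .
  qed
  let ?P = "gauss_vector :: ('d \<Rightarrow> real) measure"
  let ?W = "Pi\<^sub>M (UNIV :: nat set) (\<lambda>_. M)"
  let ?\<Omega> = "measure_pmf (pmf_of_set (UNIV :: bool set)) \<Otimes>\<^sub>M (measure_pmf (poisson_pmf 1) \<Otimes>\<^sub>M ?W)"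
  interpret \<mu>: real_distribution \<mu> by (rule \<mu>)
  interpret \<nu>: real_distribution \<nu> by (rule \<nu>)
  interpret N: real_distribution std_normal_distribution by (rule real_dist_normal_dist)
  interpret P: product_prob_space "\<lambda>_. std_normal_distribution" "UNIV :: 'd set" ..
  interpret M: prob_space M using feature_mapD(1)[OF Y] .
  interpret \<nu>P: pair_prob_space \<nu> ?P ..
  interpret S: pair_prob_space \<mu> "\<nu> \<Otimes>\<^sub>M ?P" ..
  let ?S = "\<mu> \<Otimes>\<^sub>M \<nu> \<Otimes>\<^sub>M ?P"
  \<comment> \<open>Everything is indexed by a pair of a point \<open>(h, u)\<close> and a component \<open>i\<close>; \<open>Y\<close> ignores \<open>h\<close>.\<close>
  define Y' where "Y' a = Y (snd (fst a), snd a)" for a :: "((real ^ 'd) \<times> (real ^ 'l)) \<times> 'm"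
  define K' where "K' a b = K (snd (fst a), snd a) (snd (fst b), snd b)"
    for a b :: "((real ^ 'd) \<times> (real ^ 'l)) \<times> 'm"
  have Y': "feature_map M Y' K'"
    using Y by (simp add: feature_map_def Y'_def K'_def)
  note [measurable] = feature_mapD(2)[OF Y']
  define \<Gamma> where "\<Gamma> a b = \<gamma> (snd (fst a) - snd (fst b)) $ snd a $ snd b"
    for a b :: "((real ^ 'd) \<times> (real ^ 'l)) \<times> 'm"
  have \<Gamma>: "\<Gamma> a b = (K' a a + K' b b - 2 * K' a b) / 2" for a b
    by (simp add: \<Gamma>_def K'_def \<gamma>)
  define F where "F = (\<lambda>p a (b, n :: nat, w).
    sqrt 2 * (if b then cos (mixing_phase p (fst (fst a))) else sin (mixing_phase p (fst (fst a)))) *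
    (exp (- mixing_rate p * K' a a / 2) * (exp (1 / 2) * (\<Prod>k<n. sqrt (mixing_rate p) * Y' a (w k)))))"
  have F: "feature_map ?\<Omega> (F p)
      (\<lambda>a b. cos (mixing_phase p (fst (fst a)) - mixing_phase p (fst (fst b))) * exp (- mixing_rate p * \<Gamma> a b))" for p
    using feature_map_product[OF feature_map_random_phase feature_map_exp_neg_distance[OF Y' mixing_rate_nonneg]]
    by (simp add: F_def \<Gamma> case_prod_unfold)
  note [measurable] = mixing_rate_measurable[OF \<mu> \<nu>] mixing_phase_measurable[OF \<mu> \<nu>]
  have F_meas: "(\<lambda>(p, \<omega>). F p a \<omega>) \<in> borel_measurable (?S \<Otimes>\<^sub>M ?\<Omega>)" for a
  proof -
    have "(\<lambda>z. \<Prod>k<fst (snd (snd z)). sqrt (mixing_rate (fst z)) * Y' a (snd (snd (snd z)) k))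
        \<in> borel_measurable (?S \<Otimes>\<^sub>M ?\<Omega>)"
      by (rule measurable_compose_countable[where g = "\<lambda>z. fst (snd (snd z))"]) measurable
    then show ?thesis
      unfolding F_def case_prod_unfold by measurable
  qed
  have "feature_map (?S \<Otimes>\<^sub>M ?\<Omega>) (\<lambda>a (p, \<omega>). F p a \<omega>)
      (\<lambda>a b. \<integral>p. cos (mixing_phase p (fst (fst a)) - mixing_phase p (fst (fst b))) * exp (- mixing_rate p * \<Gamma> a b) \<partial>?S)"
    by (rule feature_map_mixture[OF S.prob_space_axioms F F_meas])
      (simp add: \<Gamma>)
  from feature_map_scale[OF this, of "\<lambda>_. sqrt (\<phi> 0)"]
  have fm: "feature_map (?S \<Otimes>\<^sub>M ?\<Omega>) (\<lambda>a z. sqrt (\<phi> 0) * (case z of (p, \<omega>) \<Rightarrow> F p a \<omega>))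
      (\<lambda>a b. \<phi> 0 * (\<integral>p. cos (mixing_phase p (fst (fst a)) - mixing_phase p (fst (fst b))) * exp (- mixing_rate p * \<Gamma> a b) \<partial>?S))"
    using \<phi>0 by simp
  have mix: "\<phi> 0 * (\<integral>p. cos (mixing_phase p h - mixing_phase p h') * exp (- mixing_rate p * g) \<partial>?S)
      = 1 / (1 + g) powr r * \<phi> ((norm (h - h'))\<^sup>2 / (1 + g))"
    if g: "0 \<le> g" for h h' g
  proof -
    have powr_r: "(1 + g) powr (- real CARD('d) / 2) * (1 + g) powr - q = 1 / (1 + g) powr r"
      by (simp add: powr_add[symmetric] powr_minus_divide[symmetric] q_def)
    have \<phi>_n: "\<phi> ((norm (h - h'))\<^sup>2 / (1 + g))
        = \<phi> 0 * (\<integral>s. exp (- ((norm (h - h'))\<^sup>2 / (1 + g)) * max s 0) \<partial>\<mu>)"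
      using g by (intro \<phi>) simp
    show ?thesis
      unfolding mixing_integral[OF \<mu> \<nu> g] \<nu>_eq[OF g, symmetric] powr_r[symmetric] \<phi>_n
      by (simp only: mult_ac)
  qed
  have kernel: "(\<lambda>a b. \<phi> 0 * (\<integral>p. cos (mixing_phase p (fst (fst a)) - mixing_phase p (fst (fst b))) * exp (- mixing_rate p * \<Gamma> a b) \<partial>?S))
      = (\<lambda>(x, i) (y, j). G (x - y) $ i $ j)"
    using mix[OF \<gamma>_nonneg] by (auto simp: \<Gamma>_def assms(4) fun_eq_iff)
  have cov: "matrix_covariance_function G"
    using fm unfolding kernel by (rule matrix_covariance_function_feature_map)
  have "G 0 $ i $ i = \<phi> 0" for i
    using \<gamma>[of 0 0 i i] by (simp add: zero_prod_def assms(4))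
  with cov show ?thesis
    by (simp add: matrix_correlation_function_def)
qed

end
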